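(* Let $n\ge 1$ and let $p,q$ be integers with $0\le p<q\le n$. Let $A$ be the set of all subsets of $[n]=\{1,\dots,n\}$ whose size is between $p$ and $q$ (inclusive), and let $A'$ be the set of binary strings of length $n$ encoding the elements of $A$ (that is, all binary strings of length $n$ whose number of ones lies in $\{p,\dots,q\}$). Then there exists a universal cycle for $A'$.
   Context: A subset $B\subseteq[n]$ is encoded by the binary string $a_1\cdots a_n$ with $a_i=1$ if $i\in B$ and $a_i=0$ otherwise. A universal cycle for a finite set $A'$ of words of length $n$ over a finite alphabet is a cyclic sequence $c_0c_1\cdots c_{L-1}$ of letters, with $L=|A'|$, such that every word of $A'$ occurs exactly once among the $L$ windows $c_ic_{i+1}\cdots c_{i+n-1}$, $0\le i<L$ (indices modulo $L$). *)

theory Defs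
  imports Main
begin

(* Words are lists over an alphabet type; the binary alphabet is bool, with True for the
   letter 1 and False for the letter 0. *)

definition encode :: "nat \<Rightarrow> nat set \<Rightarrow> bool list" where
  "encode n B = map (\<lambda>i. i \<in> B) [1..<Suc n]"

definition subsets_between :: "nat \<Rightarrow> nat \<Rightarrow> nat \<Rightarrow> nat set set" where
  "subsets_between n p q = {B. B \<subseteq> {1..n} \<and> p \<le> card B \<and> card B \<le> q}"

(* The cyclic sequence may be shorter than the window, which then wraps around more than once. *)
definition cyclic_window :: "'a list \<Rightarrow> nat \<Rightarrow> nat \<Rightarrow> 'a list" where
  "cyclic_window cs n i = map (\<lambda>j. cs ! ((i + j) mod length cs)) [0..<n]"

definition universal_cycle :: "nat \<Rightarrow> 'a list set \<Rightarrow> 'a list \<Rightarrow> bool" where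
  "universal_cycle n W cs \<longleftrightarrow>
     finite W \<and> (\<forall>w\<in>W. length w = n) \<and>
     length cs = card W \<and>
     (\<forall>w\<in>W. \<exists>!i. i < length cs \<and> cyclic_window cs n i = w)"

lemma encode_subsets_between:
  "encode n ` subsets_between n p q =
     {w. length w = n \<and> p \<le> count_list w True \<and> count_list w True \<le> q}"
proof -
  have count: "count_list (encode n B) True = card B" if "B \<subseteq> {1..n}" for B
  proof -
    have "count_list (encode n B) True = length (filter (\<lambda>i. i \<in> B) [1..<Suc n])"
      unfolding encode_def by (induction n) (auto simp: count_list_append)
    also have "\<dots> = card (set (filter (\<lambda>i. i \<in> B) [1..<Suc n]))"
      by (rule distinct_card[symmetric]) simp
    also have "set (filter (\<lambda>i. i \<in> B) [1..<Suc n]) = B"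
      using that by auto
    finally show ?thesis .
  qed
  have surj: "\<exists>B. B \<subseteq> {1..n} \<and> encode n B = w" if "length w = n" for w
  proof (intro exI conjI)
    show "{i \<in> {1..n}. w ! (i - 1)} \<subseteq> {1..n}" by auto
    show "encode n {i \<in> {1..n}. w ! (i - 1)} = w"
      using that by (auto simp: encode_def list_eq_iff_nth_eq simp del: upt_Suc)
  qed
  have len: "length (encode n B) = n" for B
    by (simp add: encode_def del: upt_Suc)
  show ?thesis
  proof (intro set_eqI iffI)
    fix w assume "w \<in> encode n ` subsets_between n p q"
    then show "w \<in> {w. length w = n \<and> p \<le> count_list w True \<and> count_list w True \<le> q}"
      using count len by (auto simp: subsets_between_def)
  next
    fix w assume w: "w \<in> {w. length w = n \<and> p \<le> count_list w True \<and> count_list w True \<le> q}"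
    then obtain B where "B \<subseteq> {1..n}" "encode n B = w" using surj by blast
    then show "w \<in> encode n ` subsets_between n p q"
      using w count by (auto simp: subsets_between_def)
  qed
qed

end

theory Submission
  imports Defs "Graph_Theory.Euler"
begin

text \<open>
  Regard every word \<open>w\<close> of a set \<open>W\<close> of words of length \<open>n \<ge> 1\<close> as an arc from \<open>butlast w\<close> to
  \<open>tl w\<close>, that is, take the part of the de Bruijn graph spanned by \<open>W\<close>. A closed Euler trail
  visits each word once, and each word overlaps the next in \<open>n - 1\<close> letters, so the first letters
  of its arcs form a universal cycle (\<open>universal_cycle_of_trail\<close>). It remains to see that the
  graph is balanced and connected.

  Suppose that \<open>W\<close> is closed under rotation. Rotation maps the arcs into a vertex \<open>v\<close>
  bijectively onto the arcs out of \<open>v\<close>, which gives balance; and a word and its rotation are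
  consecutive arcs, so the rotations of one word form a closed walk. Words that differ in a single
  letter become, after a rotation, arcs with a common tail. Hence \<open>W\<close> has a universal cycle as
  soon as any two of its words are linked by changes of single letters inside \<open>W\<close>
  (\<open>universal_cycle_if_rotation_closed\<close>).

  The subsets whose size lies between \<open>p\<close> and \<open>q\<close> are linked in this way because \<open>p < q\<close>. Let
  \<open>B \<noteq> C\<close> with \<open>card B \<le> card C\<close> and pick \<open>i\<close> in \<open>C - B\<close>. If \<open>card B < q\<close>, adding \<open>i\<close> to \<open>B\<close> is
  allowed; otherwise \<open>card C = q > p\<close>, and removing \<open>i\<close> from \<open>C\<close> is allowed. Either way the
  symmetric difference shrinks (\<open>subsets_between_linked\<close>). With \<open>p = q\<close> no letter could be changed.
\<close>

section \<open>Universal cycles from closed Euler trails\<close>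

text \<open>
  The part of the de Bruijn graph spanned by the words in \<open>W\<close>. The vertices are the prefixes only:
  if \<open>W\<close> is closed under rotation, the head \<open>tl w\<close> of an arc is also the prefix of \<open>rotate1 w\<close>.
\<close>

definition word_graph :: "'a list set \<Rightarrow> ('a list, 'a list) pre_digraph" where
  "word_graph W = \<lparr>verts = butlast ` W, arcs = W, tail = butlast, head = tl\<rparr>"

lemma word_graph_simps [simp]:
  "verts (word_graph W) = butlast ` W" "arcs (word_graph W) = W"
  "tail (word_graph W) = butlast" "head (word_graph W) = tl"
  by (simp_all add: word_graph_def)

lemma cas_consecutive:
  assumes "pre_digraph.cas G u p v" and "Suc i < length p"
  shows "tail G (p ! Suc i) = head G (p ! i)"
  using assms
proof (induction p arbitrary: u i)
  case Nil
  then show ?case by simp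
next
  case (Cons e es)
  then show ?case
    by (cases i; cases es) (auto simp: pre_digraph.cas.simps)
qed

lemma cas_ends:
  assumes "pre_digraph.cas G u p v" and "p \<noteq> []"
  shows "tail G (hd p) = u" and "head G (last p) = v"
  using assms by (induction p arbitrary: u) (auto simp: pre_digraph.cas.simps)

lemma cas_cyclic:
  assumes "pre_digraph.cas G u p u" and "i < length p"
  shows "tail G (p ! (Suc i mod length p)) = head G (p ! i)"
proof (cases "Suc i = length p")
  case True
  then have "p \<noteq> []" by auto
  moreover from this have "p ! i = last p"
    using True by (metis diff_Suc_1 last_conv_nth)
  ultimately show ?thesis
    using True cas_ends[OF assms(1)] by (simp add: hd_conv_nth)
next
  case False
  then show ?thesis
    using assms cas_consecutive[OF assms(1), of i] by simp
qed

text \<open>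
  Going one step along the trail shifts the current word by one letter, so its \<open>j\<close>-th letter is
  the first letter of the arc \<open>j\<close> steps later. This also covers trails shorter than \<open>n\<close>, where
  those steps run around the trail more than once.
\<close>

lemma universal_cycle_of_trail:
  assumes len: "\<And>w. w \<in> W \<Longrightarrow> length w = n" and "1 \<le> n"
    and cas: "pre_digraph.cas (word_graph W) u ws u"
    and ws: "set ws = W" "distinct ws"
  shows "universal_cycle n W (map hd ws)"
proof -
  let ?L = "length ws"
  have letter: "hd (ws ! ((i + j) mod ?L)) = ws ! i ! j" if "i < ?L" "j < n" for i j
    using that
  proof (induction j arbitrary: i)
    case 0
    then have "length (ws ! i) = n"
      using len ws nth_mem by blast
    with 0(2) have "ws ! i \<noteq> []"
      by auto
    then show ?case
      using 0 by (simp add: hd_conv_nth)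
  next
    case (Suc j)
    let ?k = "Suc i mod ?L"
    have k: "?k < ?L"
      using Suc.prems by (intro mod_less_divisor) auto
    have lens: "length (ws ! i) = n" "length (ws ! ?k) = n"
      using len ws(1) k Suc.prems(1) nth_mem by blast+
    have shift: "butlast (ws ! ?k) = tl (ws ! i)"
      using cas_cyclic[OF cas Suc.prems(1)] by simp
    have "(i + Suc j) mod ?L = (?k + j) mod ?L"
      by (simp add: mod_add_left_eq)
    then have "hd (ws ! ((i + Suc j) mod ?L)) = ws ! ?k ! j"
      using Suc.IH[OF k] Suc.prems by simp
    also have "\<dots> = butlast (ws ! ?k) ! j"
      using lens Suc.prems by (simp add: nth_butlast)
    also have "\<dots> = ws ! i ! Suc j"
      unfolding shift using lens Suc.prems by (simp add: nth_tl)
    finally show ?case .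
  qed
  have window: "cyclic_window (map hd ws) n i = ws ! i" if "i < ?L" for i
  proof (rule nth_equalityI)
    show "length (cyclic_window (map hd ws) n i) = length (ws ! i)"
      using len that ws by (auto simp: cyclic_window_def)
    fix j assume "j < length (cyclic_window (map hd ws) n i)"
    then have "j < n" by (simp add: cyclic_window_def)
    moreover have "(i + j) mod ?L < ?L"
      using that by (intro mod_less_divisor) auto
    ultimately show "cyclic_window (map hd ws) n i ! j = ws ! i ! j"
      using letter[OF that] by (simp add: cyclic_window_def)
  qed
  have "\<exists>!i. i < ?L \<and> ws ! i = w" if "w \<in> W" for w
    using that ws by (metis in_set_conv_nth nth_eq_iff_index_eq)
  then have "\<exists>!i. i < ?L \<and> cyclic_window (map hd ws) n i = w" if "w \<in> W" for w
    using that window by (metis (lifting))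
  then show ?thesis
    using len ws distinct_card[OF ws(2)] by (auto simp: universal_cycle_def)
qed

section \<open>Rotation-closed sets of words\<close>

definition letter_changes :: "'a list set \<Rightarrow> 'a list rel" where
  "letter_changes W =
     {(v, w). v \<in> W \<and> w \<in> W \<and> (\<exists>xs a b ys. v = xs @ a # ys \<and> w = xs @ b # ys)}"

lemma sym_letter_changes: "sym (letter_changes W)"
  unfolding letter_changes_def by (rule symI) blast

lemma butlast_rotate1: "w \<noteq> [] \<Longrightarrow> butlast (rotate1 w) = tl w"
  by (cases w) auto

lemma rotate_in:
  assumes "rotate1 ` W \<subseteq> W" and "w \<in> W"
  shows "rotate k w \<in> W"
  using assms by (induction k) auto

locale rotation_closed =
  fixes W :: "'a list set"
  assumes fin: "finite W" and nonempty: "[] \<notin> W" and rot: "rotate1 ` W \<subseteq> W"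
begin

sublocale fin_digraph "word_graph W"
proof
  fix w assume "w \<in> arcs (word_graph W)"
  then have "w \<in> W" "w \<noteq> []" "rotate1 w \<in> W" using nonempty rot by auto
  then show "tail (word_graph W) w \<in> verts (word_graph W)"
    and "head (word_graph W) w \<in> verts (word_graph W)"
    using butlast_rotate1[of w] by (auto intro: rev_image_eqI)
qed (simp_all add: fin)

text \<open>
  Rotation turns a word \<open>a # v\<close>, an arc into \<open>v\<close>, into the word \<open>v @ [a]\<close>, an arc out of \<open>v\<close>.
\<close>

lemma in_degree_eq_out_degree:
  "in_degree (word_graph W) v = out_degree (word_graph W) v"
proof -
  have inj: "inj_on rotate1 W" for W :: "'a list set"
    using inj_rotate1 by (rule inj_on_subset) simp
  have "rotate1 ` W = W"
    using fin rot inj by (rule endo_inj_surj)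
  then have "rotate1 ` {w \<in> W. tl w = v} = {w \<in> W. butlast w = v}"
    using nonempty butlast_rotate1 by (smt (verit, del_insts) Collect_cong image_iff mem_Collect_eq
        set_eq_iff)
  then have "card {w \<in> W. tl w = v} = card {w \<in> W. butlast w = v}"
    using card_image[OF inj] by metis
  then show ?thesis
    by (simp add: in_degree_def out_degree_def in_arcs_def out_arcs_def)
qed

lemma reachable_rotate:
  assumes "w \<in> W"
  shows "butlast w \<rightarrow>\<^sup>*\<^bsub>word_graph W\<^esub> butlast (rotate k w)"
proof (induction k)
  case 0
  then show ?case using assms by simp
next
  case (Suc k)
  let ?v = "rotate k w"
  have v: "?v \<in> W" "?v \<noteq> []"
    using rotate_in[OF rot assms] nonempty by metis+
  have "butlast ?v \<rightarrow>\<^bsub>word_graph W\<^esub> butlast (rotate1 ?v)"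
    using v by (force simp: arcs_ends_def arc_to_ends_def butlast_rotate1)
  with Suc show ?case
    unfolding rotate_Suc by (rule reachable_adj_trans)
qed

text \<open>
  The changed letter can be rotated to the end of both words, where dropping the last letter makes
  them equal. Both words thus reach a common vertex; in the underlying undirected graph, where
  connectedness is defined, the second of these walks can simply be reversed.
\<close>

lemma reachable_letter_change:
  assumes "(v, w) \<in> letter_changes W"
  shows "butlast v \<rightarrow>\<^sup>*\<^bsub>mk_symmetric (word_graph W)\<^esub> butlast w"
proof -
  interpret S: pair_wf_digraph "mk_symmetric (word_graph W)" ..
  obtain xs a b ys where v: "v = xs @ a # ys" "v \<in> W" and w: "w = xs @ b # ys" "w \<in> W"
    using assms by (auto simp: letter_changes_def)
  have rotated: "rotate (Suc (length xs)) (xs @ c # ys) = ys @ xs @ [c]" for c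
    using rotate_append[of "xs @ [c]" ys] by simp
  have "butlast v \<rightarrow>\<^sup>*\<^bsub>mk_symmetric (word_graph W)\<^esub> (ys @ xs)"
    and "butlast w \<rightarrow>\<^sup>*\<^bsub>mk_symmetric (word_graph W)\<^esub> (ys @ xs)"
    using reachable_mk_symmetricI[OF reachable_rotate[OF v(2), of "Suc (length xs)"]]
      reachable_mk_symmetricI[OF reachable_rotate[OF w(2), of "Suc (length xs)"]]
    unfolding v(1) w(1) rotated by (simp_all add: butlast_append)
  then show ?thesis
    by (rule S.reachable_trans[OF _ symmetric_reachable[OF symmetric_mk_symmetric]])
qed

lemma reachable_letter_changes:
  assumes "(v, w) \<in> (letter_changes W)\<^sup>*" and "v \<in> W"
  shows "butlast v \<rightarrow>\<^sup>*\<^bsub>mk_symmetric (word_graph W)\<^esub> butlast w"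
  using assms(1)
proof induction
  case base
  then show ?case
    using assms(2) reachable_mk_symmetricI[OF reachable_rotate[OF assms(2), of 0]] by simp
next
  interpret S: pair_wf_digraph "mk_symmetric (word_graph W)" ..
  case (step u w)
  then show ?case
    by (intro S.reachable_trans[OF step.IH reachable_letter_change])
qed

end

theorem universal_cycle_if_rotation_closed:
  assumes "finite W" and len: "\<And>w. w \<in> W \<Longrightarrow> length w = n" and "1 \<le> n"
    and "rotate1 ` W \<subseteq> W"
    and linked: "\<And>v w. v \<in> W \<Longrightarrow> w \<in> W \<Longrightarrow> (v, w) \<in> (letter_changes W)\<^sup>*"
  shows "\<exists>cs. universal_cycle n W cs"
proof (cases "W = {}")
  case True
  then have "universal_cycle n W []"
    by (simp add: universal_cycle_def)
  then show ?thesis ..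
next
  case False
  interpret rotation_closed W
    using assms by unfold_locales force+
  have "connected (word_graph W)"
    using False linked by (intro connectedI) (auto intro!: reachable_letter_changes)
  then obtain u ws where "euler_trail u ws u"
    using closed_euler1 in_degree_eq_out_degree by blast
  then have "cas u ws u" "set ws = W" "distinct ws"
    by (auto simp: euler_trail_def trail_def awalk_def)
  then show ?thesis
    using universal_cycle_of_trail[OF len \<open>1 \<le> n\<close>] by blast
qed

section \<open>Subsets of bounded size\<close>

lemma letter_change_insert:
  assumes "B \<in> subsets_between n p q" and "insert i B \<in> subsets_between n p q"
  shows "(encode n B, encode n (insert i B)) \<in> letter_changes (encode n ` subsets_between n p q)"
proof -
  have i: "1 \<le> i" "i \<le> n"
    using assms by (auto simp: subsets_between_def)
  then have "[1..<Suc n] = [1..<i] @ i # [Suc i..<Suc n]"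
    by (metis le_SucI le_add_diff_inverse less_Suc_eq_le upt_add_eq_append upt_conv_Cons)
  then have split: "encode n D =
      map (\<lambda>j. j \<in> D) [1..<i] @ (i \<in> D) # map (\<lambda>j. j \<in> D) [Suc i..<Suc n]" for D
    by (simp add: encode_def del: upt_Suc)
  have rest: "map (\<lambda>j. j \<in> insert i B) [1..<i] = map (\<lambda>j. j \<in> B) [1..<i]"
    "map (\<lambda>j. j \<in> insert i B) [Suc i..<Suc n] = map (\<lambda>j. j \<in> B) [Suc i..<Suc n]"
    by auto
  have "\<exists>xs a b ys. encode n B = xs @ a # ys \<and> encode n (insert i B) = xs @ b # ys"
    using split[of B] split[of "insert i B", unfolded rest] by blast
  then show ?thesis
    using assms by (auto simp: letter_changes_def)
qed

lemma subsets_between_exchange: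
  assumes "p < q" and B: "B \<in> subsets_between n p q" and C: "C \<in> subsets_between n p q"
    and "B \<noteq> C" and le: "card B \<le> card C"
  obtains i where "i \<in> C - B"
    and "insert i B \<in> subsets_between n p q \<or> C - {i} \<in> subsets_between n p q"
proof -
  have fin: "finite B" "finite C"
    using B C by (auto simp: subsets_between_def intro: finite_subset)
  then obtain i where i: "i \<in> C - B"
    using \<open>B \<noteq> C\<close> le card_seteq by blast
  have "insert i B \<in> subsets_between n p q \<or> C - {i} \<in> subsets_between n p q"
    using i fin B C le \<open>p < q\<close> by (auto simp: subsets_between_def card_insert_if card_Diff_singleton)
  with i show ?thesis using that by blast
qed

text \<open>
  The exchange step changes the smaller set by an insertion or the larger one by a removal. As
  letter changes are symmetric, either end of the chain from \<open>B\<close> to \<open>C\<close> may be the one that moves,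
  and the induction on the size of the symmetric difference takes care of the rest.
\<close>

lemma subsets_between_linked:
  fixes n p q :: nat
  defines "R \<equiv> (letter_changes (encode n ` subsets_between n p q))\<^sup>*"
  assumes "p < q" and "B \<in> subsets_between n p q" and "C \<in> subsets_between n p q"
  shows "(encode n B, encode n C) \<in> R"
  using assms(3,4)
proof (induction "card (B - C \<union> (C - B))" arbitrary: B C rule: less_induct)
  case less
  have sym: "(v, u) \<in> R" if "(u, v) \<in> R" for u v
    using that sym_rtrancl[OF sym_letter_changes] unfolding R_def by (rule symD[rotated])
  have trans: "(u, w) \<in> R" if "(u, v) \<in> R" "(v, w) \<in> R" for u v w
    using that unfolding R_def by (rule rtrancl_trans)
  have insert: "(encode n X, encode n (insert i X)) \<in> R"
    if "X \<in> subsets_between n p q" "insert i X \<in> subsets_between n p q" for X i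
    unfolding R_def using letter_change_insert[OF that] by (rule r_into_rtrancl)
  have ordered: "(encode n X, encode n Y) \<in> R"
    if X: "X \<in> subsets_between n p q" and Y: "Y \<in> subsets_between n p q"
      and le: "card X \<le> card Y"
      and d: "card (X - Y \<union> (Y - X)) = card (B - C \<union> (C - B))" for X Y
  proof (cases "X = Y")
    case True
    then show ?thesis by (simp add: R_def)
  next
    case False
    then obtain i where i: "i \<in> Y - X"
      and swap: "insert i X \<in> subsets_between n p q \<or> Y - {i} \<in> subsets_between n p q"
      using subsets_between_exchange[OF \<open>p < q\<close> X Y _ le] by metis
    have fin: "finite (X - Y \<union> (Y - X))"
      using X Y by (auto simp: subsets_between_def intro: finite_subset)
    from swap show ?thesis
    proof
      assume X': "insert i X \<in> subsets_between n p q"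
      have "insert i X - Y \<union> (Y - insert i X) \<subset> X - Y \<union> (Y - X)"
        using i by blast
      then have "(encode n (insert i X), encode n Y) \<in> R"
        using less.hyps[OF _ X' Y] psubset_card_mono[OF fin] d by simp
      then show ?thesis
        using trans insert[OF X X'] by blast
    next
      assume Y': "Y - {i} \<in> subsets_between n p q"
      have "X - (Y - {i}) \<union> (Y - {i} - X) \<subset> X - Y \<union> (Y - X)"
        using i by blast
      then have "(encode n X, encode n (Y - {i})) \<in> R"
        using less.hyps[OF _ X Y'] psubset_card_mono[OF fin] d by simp
      moreover have "insert i (Y - {i}) = Y"
        using i by blast
      ultimately show ?thesis
        using trans insert[OF Y', of i] Y by simp
    qed
  qed
  show ?case
  proof (cases "card B \<le> card C")
    case True
    then show ?thesis using ordered less.prems by blast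
  next
    case False
    then show ?thesis
      using sym ordered[of C B] less.prems by (simp add: Un_commute)
  qed
qed

theorem theorem1:
  fixes n p q :: nat
  assumes "1 \<le> n" and "p < q" and "q \<le> n"
  shows "\<exists>cs. universal_cycle n (encode n ` subsets_between n p q) cs"
proof (rule universal_cycle_if_rotation_closed[OF _ _ \<open>1 \<le> n\<close>])
  let ?W = "encode n ` subsets_between n p q"
  show "finite ?W"
    by (rule finite_imageI, rule finite_subset[of _ "Pow {1..n}"])
      (auto simp: subsets_between_def)
  show "length w = n" if "w \<in> ?W" for w
    using that by (simp add: encode_subsets_between)
  have "count_list (rotate1 w) True = count_list w True" for w
    by (cases w) auto
  then show "rotate1 ` ?W \<subseteq> ?W"
    unfolding encode_subsets_between by auto
  show "(v, w) \<in> (letter_changes ?W)\<^sup>*" if "v \<in> ?W" "w \<in> ?W" for v w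
    using that subsets_between_linked[OF \<open>p < q\<close>] by blast
qed

end
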